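(* Consider the click-through rate maximization model and its online algorithm with parameter $\epsilon>0$ described in the context, and assume $D_2^*>0$, where $$D_2^*=\max_{\mathbf p\in\mathcal{F}_0}\min_i\Big\{N\sum_q\nu_q\sum_{M\in\mathcal{M}_q}p_{qM}\sum_sM_{is}-m_i\Big\}.$$ Then, with $\mathbf{Q}(\infty)$ distributed according to the stationary distribution of the Markov chain $\{\mathbf{Q}(k)\}$, $$E\Big[\sum_iQ_i(\infty)\Big]\le\frac{1}{D_2^*}\Big(D_1+\frac{D_3}{\epsilon}\Big),$$ where $D_1=\frac12\big(N(N-1)L^2+NL+\sum_i(\lceil m_i\rceil^2(m_i-\lfloor m_i\rfloor)+\lfloor m_i\rfloor^2(1-m_i+\lfloor m_i\rfloor))\big)$ and $D_3=N\max_{\mathbf p\in\mathcal{F}_0}\bar J(\mathbf p)$.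
   Context: Model. Time is slotted; a requirement cycle $k$ consists of $N$ slots $kN,\dots,kN+N-1$. There are finitely many keywords $q\ge1$, clients $i=1,\dots,n$, and $L$ webpage slots $s=1,\dots,L$. For each $q$, $\mathcal{M}_q$ is a nonempty set of $n\times L$ $\{0,1\}$-matrices with at most one $1$ per row and per column ($M_{is}=1$ means client $i$'s ad is in slot $s$). In each slot $t$ the keyword $\tilde q(t)$ equals $q\ge1$ w.p. $\nu_q=\nu\vartheta_q$ and $0$ (no query) w.p. $1-\nu$, $\nu\in(0,1)$, $\sum_q\vartheta_q=1$, i.i.d. over $t$. Click-through rates $c_{qis}\in[0,1]$. Client $i$ has an average impression requirement $m_i>0$ per cycle; $\tilde m_i(k)=\lceil m_i\rceil$ w.p. $m_i-\lfloor m_i\rfloor$ and $\lfloor m_i\rfloor$ otherwise, i.i.d. over $k$, independent of the queries. $\bar J(\mathbf p)=\sum_q\nu_q\sum_{M\in\mathcal{M}_q}p_{qM}\sum_{i,s}M_{is}c_{qis}$; $\mathcal{F}_0=\{\mathbf p:0\le p_{qM}\le1;\ \sum_{M\in\mathcal{M}_q}p_{qM}\le1\ \forall q\}$. Online algorithm (parameter $\epsilon>0$): start from a finite nonnegative vector $\mathbf{Q}(0)$. In each slot $t$ of cycle $k$ with $\tilde q(t)=q>0$ use $\tilde M^*(q,\mathbf{Q}(k))\in\arg\max_{M\in\mathcal{M}_q}\sum_{i,s}M_{is}(c_{qis}/\epsilon+Q_i(k))$. $S_i(k)=\sum_{t=kN}^{kN+N-1}\sum_s[\tilde M^*(\tilde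 q(t),\mathbf{Q}(k))]_{is}$ (slots with no query contribute $0$); $Q_i(k+1)=\max\{Q_i(k)+\tilde m_i(k)-S_i(k),0\}$. *)

theory Defs
  imports "HOL-Probability.Probability"
begin

text \<open>
  Keywords, clients and webpage slots are the elements of finite types \<open>'q\<close>, \<open>'i\<close>, \<open>'s\<close>.
  A matrix \<open>M\<close> assigning ads to slots has entry \<open>M $ i $ s\<close> for client \<open>i\<close> and slot \<open>s\<close>.
  The absence of a query in a time slot is represented by \<^term>\<open>None\<close>.
\<close>

definition assignment_matrix :: "real^'s^'i \<Rightarrow> bool" where
  "assignment_matrix M \<longleftrightarrow>
     (\<forall>i s. M $ i $ s \<in> {0, 1}) \<and>
     (\<forall>i. card {s. M $ i $ s = 1} \<le> 1) \<and>
     (\<forall>s. card {i. M $ i $ s = 1} \<le> 1)"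

text \<open>
  The conditional keyword probabilities form a pmf \<open>\<theta>\<close>, so keyword \<open>q\<close> is queried with
  probability \<open>\<nu> * pmf \<theta> q\<close>, and there is no query with probability \<open>1 - \<nu>\<close>.
\<close>

definition query_pmf :: "real \<Rightarrow> 'q pmf \<Rightarrow> 'q option pmf" where
  "query_pmf \<nu> \<theta> =
     bind_pmf (bernoulli_pmf \<nu>) (\<lambda>b. if b then map_pmf Some \<theta> else return_pmf None)"

definition requirement_pmf :: "real \<Rightarrow> int pmf" where
  "requirement_pmf r =
     map_pmf (\<lambda>b. if b then \<lceil>r\<rceil> else \<lfloor>r\<rfloor>) (bernoulli_pmf (r - of_int \<lfloor>r\<rfloor>))"

text \<open>Only the values \<open>p q M\<close> with \<open>M \<in> Ms q\<close> matter in what follows.\<close>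

definition F0 :: "('q \<Rightarrow> (real^'s^'i) set) \<Rightarrow> ('q \<Rightarrow> real^'s^'i \<Rightarrow> real) set" where
  "F0 Ms = {p. \<forall>q. (\<forall>M\<in>Ms q. 0 \<le> p q M \<and> p q M \<le> 1) \<and> (\<Sum>M\<in>Ms q. p q M) \<le> 1}"

definition Jbar ::
  "('q::finite \<Rightarrow> (real^'s^'i) set) \<Rightarrow> ('q \<Rightarrow> 'i \<Rightarrow> 's \<Rightarrow> real) \<Rightarrow> real \<Rightarrow> 'q pmf
    \<Rightarrow> ('q \<Rightarrow> real^'s^'i \<Rightarrow> real) \<Rightarrow> real" where
  "Jbar Ms c \<nu> \<theta> p =
     (\<Sum>q\<in>UNIV. \<nu> * pmf \<theta> q *
       (\<Sum>M\<in>Ms q. p q M * (\<Sum>i\<in>UNIV. \<Sum>s\<in>UNIV. M $ i $ s * c q i s)))"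

definition D1 :: "nat \<Rightarrow> nat \<Rightarrow> real^'i \<Rightarrow> real" where
  "D1 N L m = 1/2 * (real N * (real N - 1) * (real L)\<^sup>2 + real N * real L +
     (\<Sum>i\<in>UNIV. (of_int \<lceil>m $ i\<rceil>)\<^sup>2 * (m $ i - of_int \<lfloor>m $ i\<rfloor>) +
                (of_int \<lfloor>m $ i\<rfloor>)\<^sup>2 * (1 - m $ i + of_int \<lfloor>m $ i\<rfloor>)))"

text \<open>
  The suprema in \<open>D2\<close> and \<open>D3\<close> are maxima: the objectives are continuous functions of the
  finitely many values \<open>p q M\<close> with \<open>M \<in> Ms q\<close>, which range over a nonempty compact set.
\<close>

definition D2 ::
  "('q::finite \<Rightarrow> (real^'s^'i) set) \<Rightarrow> real \<Rightarrow> 'q pmf \<Rightarrow> nat \<Rightarrow> real^'i \<Rightarrow> real" where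
  "D2 Ms \<nu> \<theta> N m =
     (SUP p\<in>F0 Ms. MIN i.
        real N * (\<Sum>q\<in>UNIV. \<nu> * pmf \<theta> q *
          (\<Sum>M\<in>Ms q. p q M * (\<Sum>s\<in>UNIV. M $ i $ s))) - m $ i)"

definition D3 ::
  "('q::finite \<Rightarrow> (real^'s^'i) set) \<Rightarrow> ('q \<Rightarrow> 'i \<Rightarrow> 's \<Rightarrow> real) \<Rightarrow> real \<Rightarrow> 'q pmf
    \<Rightarrow> nat \<Rightarrow> real" where
  "D3 Ms c \<nu> \<theta> N = real N * (SUP p\<in>F0 Ms. Jbar Ms c \<nu> \<theta> p)"

text \<open>
  \<open>sel q x\<close> is the matrix used for a query of keyword \<open>q\<close> in a cycle whose initial queue
  vector is \<open>x\<close>; ties between maximizers are broken arbitrarily.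
\<close>

definition online_selection ::
  "('q \<Rightarrow> (real^'s^'i) set) \<Rightarrow> ('q \<Rightarrow> 'i \<Rightarrow> 's \<Rightarrow> real) \<Rightarrow> real
    \<Rightarrow> ('q \<Rightarrow> real^'i \<Rightarrow> real^'s^'i) \<Rightarrow> bool" where
  "online_selection Ms c \<epsilon> sel \<longleftrightarrow>
     (\<forall>q x. (\<forall>i. 0 \<le> x $ i) \<longrightarrow>
        is_arg_max (\<lambda>M. \<Sum>i\<in>UNIV. \<Sum>s\<in>UNIV. M $ i $ s * (c q i s / \<epsilon> + x $ i))
          (\<lambda>M. M \<in> Ms q) (sel q x))"

text \<open>\<open>qs t\<close> is the query in the \<open>t\<close>-th slot of the current cycle, \<open>t < N\<close>.\<close>

definition service ::
  "('q \<Rightarrow> real^'i \<Rightarrow> real^'s^'i) \<Rightarrow> nat \<Rightarrow> real^'i \<Rightarrow> (nat \<Rightarrow> 'q option) \<Rightarrow> 'i \<Rightarrow> real" where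
  "service sel N x qs i =
     (\<Sum>t<N. case qs t of None \<Rightarrow> 0 | Some q \<Rightarrow> \<Sum>s\<in>UNIV. sel q x $ i $ s)"

definition queue_update ::
  "('q \<Rightarrow> real^'i \<Rightarrow> real^'s^'i) \<Rightarrow> nat \<Rightarrow> real^'i \<Rightarrow> (nat \<Rightarrow> 'q option) \<Rightarrow> int^'i \<Rightarrow> real^'i" where
  "queue_update sel N x qs r =
     (\<chi> i. max (x $ i + of_int (r $ i) - service sel N x qs i) 0)"

text \<open>
  One-cycle transition law of the queue vector: the \<open>N\<close> queries of the cycle are i.i.d. and
  independent of the requirement vector, whose joint law over the clients is \<open>\<mu>\<close>.
\<close>

definition queue_kernel ::
  "('q \<Rightarrow> real^'i \<Rightarrow> real^'s^'i) \<Rightarrow> nat \<Rightarrow> real \<Rightarrow> 'q pmf \<Rightarrow> (int^'i) pmf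
    \<Rightarrow> real^'i \<Rightarrow> (real^'i) pmf" where
  "queue_kernel sel N \<nu> \<theta> \<mu> x =
     map_pmf (\<lambda>(qs, r). queue_update sel N x qs r)
       (pair_pmf (Pi_pmf {..<N} None (\<lambda>_. query_pmf \<nu> \<theta>)) \<mu>)"

primrec chain_law :: "('a \<Rightarrow> 'a pmf) \<Rightarrow> 'a \<Rightarrow> nat \<Rightarrow> 'a pmf" where
  "chain_law K x0 0 = return_pmf x0"
| "chain_law K x0 (Suc k) = bind_pmf (chain_law K x0 k) K"

text \<open>
  The chain started in \<open>x0\<close> lives on the countable set of states that it visits with positive
  probability, so its stationary distributions are pmfs.
\<close>

definition stationary_distribution :: "('a \<Rightarrow> 'a pmf) \<Rightarrow> 'a \<Rightarrow> 'a pmf \<Rightarrow> bool" where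
  "stationary_distribution K x0 \<pi> \<longleftrightarrow>
     set_pmf \<pi> \<subseteq> (\<Union>k. set_pmf (chain_law K x0 k)) \<and> bind_pmf \<pi> K = \<pi>"

end

(*
  The quadratic function V(x) = (sum_i x_i^2) / 2 is a Lyapunov function of the queue chain.
  In one cycle its expectation grows by at most D1 + sum_i x_i (m_i - E S_i). The matrices
  maximize the sum of revenue / epsilon and queue-weighted service, so comparing them with an
  arbitrary p in F0 trades the service deficit for revenue, which is at most D3 per cycle; a p
  attaining (or approaching) D2 gives the drift bound D1 + D3 / epsilon - D2 * sum_i x_i. In
  stationarity the expected drift should vanish. As V need not be integrable a priori, V is
  truncated to min(V, n), whose drift is controlled by concavity of min, and Fatou's lemma
  removes the truncation.
*)

theory Submission
  imports Defs
begin

section \<open>Lyapunov drift under a stationary distribution\<close>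

lemma expectation_bind_pmf_bounded:
  fixes f :: "'b \<Rightarrow> real"
  assumes "\<And>y. \<bar>f y\<bar> \<le> B"
  shows "measure_pmf.expectation (bind_pmf M K) f
    = measure_pmf.expectation M (\<lambda>x. measure_pmf.expectation (K x) f)"
  unfolding measure_pmf_bind using assms
  by (intro integral_bind[where K = "count_space UNIV" and B' = 1 and B = B])
     (auto simp: measure_subprob measure_pmf.emeasure_space_1)

text \<open>If \<open>V\<close> were integrable under \<open>\<pi>\<close>, integrating the drift
  inequality and cancelling the two equal expectations of \<open>V\<close> would suffice. Only the
  one-step integrals of \<open>V\<close> are assumed finite here. Integrability of \<open>f\<close>
  is part of the conclusion because a Bochner integral that does not exist has value 0, which would
  make the bound meaningless.\<close>

lemma stationary_expectation_le:
  fixes V f :: "'a \<Rightarrow> real"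
  assumes stat: "bind_pmf \<pi> K = \<pi>"
    and V: "\<And>x. 0 \<le> V x"
    and f: "\<And>x. x \<in> set_pmf \<pi> \<Longrightarrow> 0 \<le> f x"
    and int: "\<And>x. x \<in> set_pmf \<pi> \<Longrightarrow> integrable (measure_pmf (K x)) V"
    and drift: "\<And>x. x \<in> set_pmf \<pi> \<Longrightarrow> measure_pmf.expectation (K x) V \<le> V x - f x + b"
  shows "integrable (measure_pmf \<pi>) f \<and> measure_pmf.expectation \<pi> f \<le> b"
proof -
  \<comment> \<open>\<open>h n\<close> bounds the one-step drift of \<open>min V n\<close> from
    above, since \<open>min _ n\<close> is concave and monotone. Pointwise it tends to
    \<open>b - f\<close>.\<close>
  define h where "h n x = min (V x - f x + b) (real n) - min (V x) (real n)" for n x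
  \<comment> \<open>This lower bound keeps \<open>min (V x - f x + b) n\<close> between 0 and
    \<open>n\<close>, hence integrable.\<close>
  have pos: "0 \<le> V x - f x + b" if "x \<in> set_pmf \<pi>" for x
  proof -
    have "0 \<le> measure_pmf.expectation (K x) V"
      using V by (intro Bochner_Integration.integral_nonneg) auto
    then show ?thesis using drift[OF that] by linarith
  qed
  have trunc_bound: "\<bar>min (V x) (real n)\<bar> \<le> real n" for n x
    using V[of x] by auto
  have int_trunc: "integrable (measure_pmf p) (\<lambda>x. min (V x) (real n))" for n and p :: "'a pmf"
    using trunc_bound
    by (intro measure_pmf.integrable_const_bound[where B = "real n"]) auto
  have int_shift: "integrable (measure_pmf \<pi>) (\<lambda>x. min (V x - f x + b) (real n))" for n
    using pos
    by (intro measure_pmf.integrable_const_bound[where B = "real n"])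
       (auto simp: AE_measure_pmf_iff)
  have trunc: "measure_pmf.expectation (K x) (\<lambda>y. min (V y) (real n)) \<le> min (V x - f x + b) (real n)"
    if x: "x \<in> set_pmf \<pi>" for x n
  proof -
    have "measure_pmf.expectation (K x) (\<lambda>y. min (V y) (real n)) \<le> measure_pmf.expectation (K x) V"
      by (intro integral_mono int_trunc int x) auto
    moreover have "measure_pmf.expectation (K x) (\<lambda>y. min (V y) (real n))
        \<le> measure_pmf.expectation (K x) (\<lambda>y. real n)"
      by (intro integral_mono int_trunc) auto
    ultimately show ?thesis using drift[OF x] by simp
  qed
  \<comment> \<open>For the bounded function \<open>min V n\<close> the exchange of expectations is
    legitimate, so stationarity makes its mean drift exactly 0.\<close>
  have h_nonneg: "0 \<le> measure_pmf.expectation \<pi> (h n)" for n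
  proof -
    have "measure_pmf.expectation \<pi> (\<lambda>x. min (V x) (real n))
        = measure_pmf.expectation (bind_pmf \<pi> K) (\<lambda>x. min (V x) (real n))"
      by (simp add: stat)
    also have "\<dots> = measure_pmf.expectation \<pi>
        (\<lambda>x. measure_pmf.expectation (K x) (\<lambda>y. min (V y) (real n)))"
      using trunc_bound by (rule expectation_bind_pmf_bounded)
    also have "\<dots> \<le> measure_pmf.expectation \<pi> (\<lambda>x. min (V x - f x + b) (real n))"
    proof (intro integral_mono_AE int_shift)
      have "\<bar>measure_pmf.expectation (K x) (\<lambda>y. min (V y) (real n))\<bar> \<le> real n" for x
      proof -
        have "0 \<le> measure_pmf.expectation (K x) (\<lambda>y. min (V y) (real n))"
          using V by (intro Bochner_Integration.integral_nonneg) auto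
        moreover have "measure_pmf.expectation (K x) (\<lambda>y. min (V y) (real n))
          \<le> measure_pmf.expectation (K x) (\<lambda>y. real n)"
          by (intro integral_mono int_trunc) auto
        ultimately show ?thesis by simp
      qed
      then show "integrable (measure_pmf \<pi>)
          (\<lambda>x. measure_pmf.expectation (K x) (\<lambda>y. min (V y) (real n)))"
        by (intro measure_pmf.integrable_const_bound[where B = "real n"]) auto
    qed (use trunc in \<open>auto simp: AE_measure_pmf_iff\<close>)
    finally show ?thesis
      unfolding h_def using int_trunc int_shift by simp
  qed
  \<comment> \<open>\<open>h n\<close> is at most \<open>max (b - f) 0\<close>, so \<open>B\<close>
    dominates it and \<open>B - h n\<close> is nonnegative, as Fatou's lemma requires. The maximum
    with 0 covers a negative \<open>b\<close>, and it keeps the embedding into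
    \<open>ennreal\<close> faithful.\<close>
  define B where "B = max b 0"
  have h_le: "h n x \<le> B" if "x \<in> set_pmf \<pi>" for n x
    using f[OF that] by (auto simp: h_def B_def)
  have int_h: "integrable (measure_pmf \<pi>) (h n)" for n
    unfolding h_def by (intro Bochner_Integration.integrable_diff int_trunc int_shift)
  \<comment> \<open>Once \<open>n\<close> exceeds both \<open>V x\<close> and
    \<open>V x - f x + b\<close>, neither truncation is active and the sequence is constant.\<close>
  have lim: "(\<lambda>n. ennreal (B - h n x)) \<longlonglongrightarrow> ennreal (f x + (B - b))" for x
  proof (intro tendsto_ennrealI tendsto_eventually)
    show "\<forall>\<^sub>F n in sequentially. B - h n x = f x + (B - b)"
      using eventually_ge_at_top[of "nat \<lceil>max (V x) (V x - f x + b)\<rceil>"]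
      by eventually_elim (auto simp: h_def min_def nat_le_iff ceiling_le_iff)
  qed
  have "(\<integral>\<^sup>+x. ennreal (f x + (B - b)) \<partial>measure_pmf \<pi>)
      = (\<integral>\<^sup>+x. liminf (\<lambda>n. ennreal (B - h n x)) \<partial>measure_pmf \<pi>)"
    by (simp add: lim_imp_Liminf[OF _ lim])
  also have "\<dots> \<le> liminf (\<lambda>n. \<integral>\<^sup>+x. ennreal (B - h n x) \<partial>measure_pmf \<pi>)"
    by (intro nn_integral_liminf) auto
  also have "\<dots> \<le> liminf (\<lambda>n::nat. ennreal B)"
  proof (intro Liminf_mono always_eventually allI)
    fix n
    have "(\<integral>\<^sup>+x. ennreal (B - h n x) \<partial>measure_pmf \<pi>)
        = ennreal (measure_pmf.expectation \<pi> (\<lambda>x. B - h n x))"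
      by (intro nn_integral_eq_integral) (use h_le int_h in \<open>auto simp: AE_measure_pmf_iff\<close>)
    also have "\<dots> \<le> ennreal B"
      using h_nonneg[of n] int_h[of n] by (intro ennreal_leI) simp
    finally show "(\<integral>\<^sup>+x. ennreal (B - h n x) \<partial>measure_pmf \<pi>) \<le> ennreal B" .
  qed
  also have "\<dots> = ennreal B"
    by (simp add: Liminf_const)
  finally have le: "(\<integral>\<^sup>+x. ennreal (f x + (B - b)) \<partial>measure_pmf \<pi>) \<le> ennreal B" .
  have nonneg: "0 \<le> f x + (B - b)" if "x \<in> set_pmf \<pi>" for x
    using f[OF that] by (auto simp: B_def)
  have int_fB: "integrable (measure_pmf \<pi>) (\<lambda>x. f x + (B - b))"
    using nonneg le
    by (intro integrableI_nonneg) (auto simp: AE_measure_pmf_iff intro: le_less_trans)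
  then have int_f: "integrable (measure_pmf \<pi>) f"
    using Bochner_Integration.integrable_diff[OF int_fB, of "\<lambda>_. B - b"] by simp
  have "ennreal (measure_pmf.expectation \<pi> (\<lambda>x. f x + (B - b))) \<le> ennreal B"
    using le nonneg by (subst (asm) nn_integral_eq_integral[OF int_fB]) (auto simp: AE_measure_pmf_iff)
  then have "measure_pmf.expectation \<pi> (\<lambda>x. f x + (B - b)) \<le> B"
    by (subst (asm) ennreal_le_iff) (auto simp: B_def)
  with int_f show ?thesis by simp
qed

section \<open>Assignment matrices\<close>

lemma finite_vec_in:
  assumes "finite A"
  shows "finite {v :: 'a^'n. \<forall>i. v $ i \<in> A}"
proof -
  have "finite (vec_lambda ` (PiE (UNIV :: 'n set) (\<lambda>_. A)))"
    using assms by (intro finite_imageI finite_PiE) auto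
  moreover have "v \<in> vec_lambda ` (PiE (UNIV :: 'n set) (\<lambda>_. A))"
    if "\<forall>i. v $ i \<in> A" for v :: "'a^'n"
    using that by (intro image_eqI[of _ _ "vec_nth v"]) auto
  ultimately show ?thesis
    by (auto intro: finite_subset)
qed

text \<open>All entries come from a two-element set. Finiteness makes the sums over
  \<open>Ms q\<close> genuine, as a sum over an infinite set is 0 by convention.\<close>

lemma finite_assignment_matrices: "finite {M :: real^'s^'i. assignment_matrix M}"
proof -
  have "finite {M :: real^'s^'i. \<forall>i. M $ i \<in> {v. \<forall>s. v $ s \<in> {0, 1}}}"
    by (intro finite_vec_in) simp
  then show ?thesis
    by (rule finite_subset[rotated]) (auto simp: assignment_matrix_def)
qed

lemma assignment_matrix_entry:
  assumes "assignment_matrix M"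
  shows "0 \<le> M $ i $ s"
  using assms by (metis assignment_matrix_def insertE order_refl singletonD zero_le_one)

lemma sum_zero_one_eq_card:
  fixes f :: "'a \<Rightarrow> real"
  assumes "finite A" and "\<And>x. x \<in> A \<Longrightarrow> f x \<in> {0, 1}"
  shows "sum f A = card {x \<in> A. f x = 1}"
proof -
  have "sum f A = (\<Sum>x\<in>A. if f x = 1 then 1 else 0)"
    using assms(2) by (intro sum.cong) auto
  also have "\<dots> = (\<Sum>x\<in>{x \<in> A. f x = 1}. 1)"
    by (rule sum.inter_filter[OF assms(1), symmetric])
  finally show ?thesis by simp
qed

lemma assignment_matrix_row_sum:
  assumes "assignment_matrix M"
  shows "(\<Sum>s\<in>UNIV. M $ i $ s) \<le> 1"
  using assms by (subst sum_zero_one_eq_card) (auto simp: assignment_matrix_def)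

lemma assignment_matrix_column_sum:
  assumes "assignment_matrix M"
  shows "(\<Sum>i\<in>UNIV. M $ i $ s) \<le> 1"
  using assms by (subst sum_zero_one_eq_card) (auto simp: assignment_matrix_def)

section \<open>Expectations of queries and requirements\<close>

lemma expectation_query_pmf:
  fixes g :: "'q::finite option \<Rightarrow> real"
  assumes "0 \<le> \<nu>" and "\<nu> \<le> 1"
  shows "measure_pmf.expectation (query_pmf \<nu> \<theta>) g
    = (\<Sum>q\<in>UNIV. \<nu> * pmf \<theta> q * g (Some q)) + (1 - \<nu>) * g None"
proof -
  have "measure_pmf.expectation \<theta> (\<lambda>q. g (Some q)) = (\<Sum>q\<in>UNIV. g (Some q) * pmf \<theta> q)"
    by (intro integral_measure_pmf_real) auto
  then show ?thesis
    unfolding query_pmf_def using assms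
    by (subst pmf_expectation_bind[where A = UNIV])
       (auto simp: UNIV_bool sum_distrib_left mult_ac)
qed

text \<open>Taking the square for \<open>g\<close> yields the summands of \<open>D1\<close>. At an
  integer \<open>r\<close> the two values coincide and the first weight is 0.\<close>

lemma expectation_requirement_pmf:
  fixes g :: "int \<Rightarrow> real"
  shows "measure_pmf.expectation (requirement_pmf r) g
    = g \<lceil>r\<rceil> * (r - \<lfloor>r\<rfloor>) + g \<lfloor>r\<rfloor> * (1 - r + \<lfloor>r\<rfloor>)"
proof -
  have "r - \<lfloor>r\<rfloor> \<le> 1" by linarith
  then show ?thesis
    by (simp add: requirement_pmf_def algebra_simps)
qed

text \<open>Randomized rounding is unbiased. The integer case is separate because the ceiling is the
  floor plus 1 only off the integers.\<close>

lemma expectation_requirement_pmf_id: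
  "measure_pmf.expectation (requirement_pmf r) of_int = r"
proof (cases "r \<in> \<int>")
  case True
  then show ?thesis
    by (auto simp: expectation_requirement_pmf elim!: Ints_cases)
next
  case False
  then have "\<lceil>r\<rceil> = \<lfloor>r\<rfloor> + 1"
    by (simp add: ceiling_altdef Ints_def) (metis rangeI)
  then show ?thesis
    by (simp add: expectation_requirement_pmf algebra_simps)
qed

lemma expectation_Pi_pmf_component:
  fixes g :: "'b \<Rightarrow> real"
  assumes "finite A" and "t \<in> A"
  shows "measure_pmf.expectation (Pi_pmf A d p) (\<lambda>f. g (f t)) = measure_pmf.expectation (p t) g"
  using integral_map_pmf[of "\<lambda>f. f t" "Pi_pmf A d p" g] assms by (simp add: Pi_pmf_component)


section \<open>Service within one cycle\<close>

lemma service_bounds: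
  fixes sel :: "'q \<Rightarrow> real^'i \<Rightarrow> real^'s^'i"
  assumes M: "\<And>q. assignment_matrix (sel q x)"
  shows service_nonneg: "0 \<le> service sel N x qs i"
    and service_le: "service sel N x qs i \<le> real N"
    and sum_service_le: "(\<Sum>i\<in>UNIV. service sel N x qs i) \<le> real N * real CARD('s)"
proof -
  show "0 \<le> service sel N x qs i"
    unfolding service_def
    by (intro sum_nonneg) (auto split: option.split intro!: sum_nonneg assignment_matrix_entry M)
  have "service sel N x qs i \<le> (\<Sum>t<N. 1)"
    unfolding service_def
    by (intro sum_mono) (auto split: option.split intro!: assignment_matrix_row_sum M)
  then show "service sel N x qs i \<le> real N" by simp
  have total: "(\<Sum>i\<in>UNIV. \<Sum>s\<in>UNIV. sel q x $ i $ s) \<le> real CARD('s)" for q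
  proof -
    have "(\<Sum>i\<in>UNIV. \<Sum>s\<in>UNIV. sel q x $ i $ s) = (\<Sum>s\<in>UNIV. \<Sum>i\<in>UNIV. sel q x $ i $ s)"
      by (rule sum.swap)
    also have "\<dots> \<le> (\<Sum>s\<in>(UNIV :: 's set). 1)"
      by (intro sum_mono assignment_matrix_column_sum M)
    finally show ?thesis by simp
  qed
  have "(\<Sum>i\<in>UNIV. service sel N x qs i)
      = (\<Sum>t<N. \<Sum>i\<in>UNIV. case qs t of None \<Rightarrow> 0 | Some q \<Rightarrow> \<Sum>s\<in>UNIV. sel q x $ i $ s)"
    unfolding service_def by (rule sum.swap)
  also have "\<dots> \<le> (\<Sum>t<N. real CARD('s))"
  proof (intro sum_mono)
    show "(\<Sum>i\<in>UNIV. case qs t of None \<Rightarrow> 0 | Some q \<Rightarrow> \<Sum>s\<in>UNIV. sel q x $ i $ s)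
        \<le> real CARD('s)" for t
      using total by (cases "qs t") auto
  qed
  finally show "(\<Sum>i\<in>UNIV. service sel N x qs i) \<le> real N * real CARD('s)" by simp
qed

text \<open>A client gets at most one slot per query, so \<open>S_i \<le> N\<close> and
  \<open>S_i^2 \<le> N * S_i\<close>. Summing over the clients gives \<open>N^2 * L\<close>, which
  \<open>L \<le> L^2\<close> turns into the form occurring in \<open>D1\<close>. The bound holds for
  every query sequence, not just in expectation.\<close>

lemma sum_service_squared_le:
  fixes sel :: "'q \<Rightarrow> real^'i \<Rightarrow> real^'s^'i"
  assumes M: "\<And>q. assignment_matrix (sel q x)" and "0 < N"
  shows "(\<Sum>i\<in>UNIV. (service sel N x qs i)\<^sup>2)
    \<le> real N * (real N - 1) * (real CARD('s))\<^sup>2 + real N * real CARD('s)"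
proof -
  have "(\<Sum>i\<in>UNIV. (service sel N x qs i)\<^sup>2) \<le> (\<Sum>i\<in>UNIV. real N * service sel N x qs i)"
    by (intro sum_mono) (auto simp: power2_eq_square intro!: mult_right_mono service_bounds M)
  also have "\<dots> \<le> real N * (real N * real CARD('s))"
    unfolding sum_distrib_left[symmetric] by (intro mult_left_mono sum_service_le M) simp
  also have "\<dots> = real N * (real N - 1) * real CARD('s) + real N * real CARD('s)"
    by (simp add: algebra_simps)
  also have "real N * (real N - 1) * real CARD('s) \<le> real N * (real N - 1) * (real CARD('s))\<^sup>2"
  proof (intro mult_left_mono mult_nonneg_nonneg)
    have "1 \<le> real CARD('s)"
      using zero_less_card_finite[where 'a = 's] by linarith
    then show "real CARD('s) \<le> (real CARD('s))\<^sup>2"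
      by (simp add: self_le_power)
  qed (use \<open>0 < N\<close> in auto)
  finally show ?thesis by simp
qed

lemma expectation_service:
  fixes sel :: "'q::finite \<Rightarrow> real^'i \<Rightarrow> real^'s^'i"
  assumes "0 \<le> \<nu>" and "\<nu> \<le> 1"
  shows "measure_pmf.expectation (Pi_pmf {..<N} None (\<lambda>_. query_pmf \<nu> \<theta>)) (\<lambda>qs. service sel N x qs i)
    = real N * (\<Sum>q\<in>UNIV. \<nu> * pmf \<theta> q * (\<Sum>s\<in>UNIV. sel q x $ i $ s))"
proof -
  let ?P = "Pi_pmf {..<N} None (\<lambda>_. query_pmf \<nu> \<theta>)"
  let ?g = "\<lambda>k. case k of None \<Rightarrow> 0 | Some q \<Rightarrow> \<Sum>s\<in>UNIV. sel q x $ i $ s"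
  have "finite (set_pmf ?P)"
    by (auto simp: set_Pi_pmf intro: finite_PiE_dflt)
  then have "measure_pmf.expectation ?P (\<lambda>qs. service sel N x qs i)
      = (\<Sum>t<N. measure_pmf.expectation ?P (\<lambda>qs. ?g (qs t)))"
    unfolding service_def
    by (intro Bochner_Integration.integral_sum integrable_measure_pmf_finite)
  also have "\<dots> = (\<Sum>t<N. measure_pmf.expectation (query_pmf \<nu> \<theta>) ?g)"
    by (intro sum.cong refl expectation_Pi_pmf_component) auto
  finally show ?thesis
    using assms by (simp add: expectation_query_pmf)
qed

section \<open>Comparison of the algorithm with points of \<open>F0\<close>\<close>

lemma F0_nonempty: "F0 Ms \<noteq> {}"
  by (auto simp: F0_def intro!: exI[of _ "\<lambda>_ _. 0"])

text \<open>Revenues are nonnegative, so replacing every \<open>p q M\<close> by 1 gives a bound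
  independent of \<open>p\<close>. Boundedness is what makes the supremum in \<open>D3\<close> an
  actual upper bound.\<close>

lemma bdd_above_Jbar:
  fixes Ms :: "'q::finite \<Rightarrow> (real^'s^'i) set"
  assumes M: "\<And>q M. M \<in> Ms q \<Longrightarrow> assignment_matrix M"
    and c: "\<And>q i s. 0 \<le> c q i s" and "0 \<le> \<nu>"
  shows "bdd_above (Jbar Ms c \<nu> \<theta> ` F0 Ms)"
proof (rule bdd_aboveI2)
  fix p assume p: "p \<in> F0 Ms"
  have "0 \<le> (\<Sum>i\<in>UNIV. \<Sum>s\<in>UNIV. M $ i $ s * c q i s)" if "M \<in> Ms q" for q M
    by (intro sum_nonneg mult_nonneg_nonneg assignment_matrix_entry M[OF that] c)
  then show "Jbar Ms c \<nu> \<theta> p \<le> (\<Sum>q\<in>UNIV. \<nu> * pmf \<theta> q *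
       (\<Sum>M\<in>Ms q. 1 * (\<Sum>i\<in>UNIV. \<Sum>s\<in>UNIV. M $ i $ s * c q i s)))"
    unfolding Jbar_def using p \<open>0 \<le> \<nu>\<close>
    by (intro sum_mono mult_left_mono mult_right_mono mult_nonneg_nonneg) (auto simp: F0_def)
qed

text \<open>The left-hand side is the linear part of the expected drift at \<open>x\<close>. The
  algorithm maximizes revenue divided by \<open>\<epsilon>\<close> plus queue-weighted service, so
  any service it lacks against some \<open>p\<close> in \<open>F0\<close> is paid for by its own
  revenue.\<close>

lemma selection_drift_le:
  fixes Ms :: "'q::finite \<Rightarrow> (real^'s^'i) set" and m x :: "real^'i"
  assumes M: "\<And>q M. M \<in> Ms q \<Longrightarrow> assignment_matrix M"
    and c: "\<And>q i s. 0 \<le> c q i s"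
    and "0 \<le> \<nu>" and "0 < \<epsilon>" and sel: "online_selection Ms c \<epsilon> sel"
    and x: "\<And>i. 0 \<le> x $ i"
  shows "(\<Sum>i\<in>UNIV. x $ i *
        (m $ i - real N * (\<Sum>q\<in>UNIV. \<nu> * pmf \<theta> q * (\<Sum>s\<in>UNIV. sel q x $ i $ s))))
    \<le> D3 Ms c \<nu> \<theta> N / \<epsilon> - D2 Ms \<nu> \<theta> N m * (\<Sum>i\<in>UNIV. x $ i)"
proof -
  define G where "G p i = real N * (\<Sum>q\<in>UNIV. \<nu> * pmf \<theta> q *
    (\<Sum>M\<in>Ms q. p q M * (\<Sum>s\<in>UNIV. M $ i $ s)))" for p i
  \<comment> \<open>The point mass on the selected matrices represents the algorithm at state
    \<open>x\<close> as a member of \<open>F0\<close>.\<close>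
  define ps where "ps q M = (if M = sel q x then 1 else 0 :: real)" for q M
  define w where "w q M = (\<Sum>i\<in>UNIV. \<Sum>s\<in>UNIV. M $ i $ s * (c q i s / \<epsilon> + x $ i))" for q M
  define X where "X = (\<Sum>i\<in>UNIV. x $ i)"
  let ?J = "Jbar Ms c \<nu> \<theta>"
  have fin: "finite (Ms q)" for q
    by (rule finite_subset[OF _ finite_assignment_matrices]) (auto intro: M)
  have sel_in: "sel q x \<in> Ms q" and sel_max: "M \<in> Ms q \<Longrightarrow> w q M \<le> w q (sel q x)" for q M
    using sel x unfolding online_selection_def is_arg_max_linorder w_def by blast+
  have w_nonneg: "0 \<le> w q M" if "M \<in> Ms q" for q M
    unfolding w_def using c x \<open>0 < \<epsilon>\<close>
    by (intro sum_nonneg mult_nonneg_nonneg assignment_matrix_entry M[OF that] add_nonneg_nonneg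
        divide_nonneg_pos)
  have sum_ps: "(\<Sum>M\<in>Ms q. ps q M * f M) = f (sel q x)" for q f
    unfolding ps_def using fin[of q] sel_in[of q] by (simp add: if_distrib[of "\<lambda>a. a * _"] cong: if_cong)
  have ps: "ps \<in> F0 Ms"
    using sum_ps[where f = "\<lambda>_. 1"] by (auto simp: F0_def ps_def)
  \<comment> \<open>The weight maximized by the algorithm splits into the revenue and the service of the queues.\<close>
  have split: "real N * (\<Sum>q\<in>UNIV. \<nu> * pmf \<theta> q * (\<Sum>M\<in>Ms q. p q M * w q M))
      = real N * ?J p / \<epsilon> + (\<Sum>i\<in>UNIV. x $ i * G p i)" for p
  proof -
    have w: "w q M = (\<Sum>i\<in>UNIV. \<Sum>s\<in>UNIV. M $ i $ s * c q i s) / \<epsilon>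
        + (\<Sum>i\<in>UNIV. x $ i * (\<Sum>s\<in>UNIV. M $ i $ s))" for q M
      unfolding w_def
      by (simp add: distrib_left sum.distrib sum_divide_distrib sum_distrib_left mult_ac)
    have "(\<Sum>i\<in>UNIV. x $ i * G p i) = real N * (\<Sum>q\<in>UNIV. \<nu> * pmf \<theta> q *
        (\<Sum>M\<in>Ms q. p q M * (\<Sum>i\<in>UNIV. x $ i * (\<Sum>s\<in>UNIV. M $ i $ s))))"
    proof -
      have "(\<Sum>i\<in>UNIV. x $ i * G p i) = (\<Sum>i\<in>UNIV. \<Sum>q\<in>UNIV. \<Sum>M\<in>Ms q.
          real N * (\<nu> * pmf \<theta> q * (p q M * (x $ i * (\<Sum>s\<in>UNIV. M $ i $ s)))))"
        unfolding G_def sum_distrib_left[of _ "\<lambda>M. p _ M * _"] sum_distrib_left[of _ "\<lambda>q. sum _ (Ms q)"]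
        by (simp only: sum_distrib_left mult_ac)
      also have "\<dots> = (\<Sum>q\<in>UNIV. \<Sum>M\<in>Ms q. \<Sum>i\<in>UNIV.
          real N * (\<nu> * pmf \<theta> q * (p q M * (x $ i * (\<Sum>s\<in>UNIV. M $ i $ s)))))"
        by (subst sum.swap, intro sum.cong refl, subst sum.swap) simp
      finally show ?thesis
        by (simp only: sum_distrib_left)
    qed
    moreover have "real N * ?J p / \<epsilon> = real N * (\<Sum>q\<in>UNIV. \<nu> * pmf \<theta> q *
        (\<Sum>M\<in>Ms q. p q M * ((\<Sum>i\<in>UNIV. \<Sum>s\<in>UNIV. M $ i $ s * c q i s) / \<epsilon>)))"
      unfolding Jbar_def by (simp add: sum_divide_distrib[symmetric])
    ultimately show ?thesis
      unfolding w by (simp add: distrib_left sum.distrib)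
  qed
  have G_ps: "G ps i = real N * (\<Sum>q\<in>UNIV. \<nu> * pmf \<theta> q * (\<Sum>s\<in>UNIV. sel q x $ i $ s))" for i
    unfolding G_def sum_ps ..
  define Z where "Z = (\<Sum>i\<in>UNIV. x $ i * m $ i)"
  define Y where "Y = (\<Sum>i\<in>UNIV. x $ i * G ps i)"
  have main: "(MIN i. G p i - m $ i) * X \<le> D3 Ms c \<nu> \<theta> N / \<epsilon> + Y - Z" if p: "p \<in> F0 Ms" for p
  proof -
    \<comment> \<open>The queue lengths serve as nonnegative weights, so the minimum bounds the
      weighted sum from below.\<close>
    have "(MIN i. G p i - m $ i) * X \<le> (\<Sum>i\<in>UNIV. (G p i - m $ i) * x $ i)"
      unfolding X_def sum_distrib_left by (intro sum_mono mult_right_mono x Min_le) auto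
    also have "\<dots> = (\<Sum>i\<in>UNIV. x $ i * G p i) - Z"
      by (simp add: Z_def right_diff_distrib sum_subtractf mult.commute[of _ "x $ _"])
    also have "(\<Sum>i\<in>UNIV. x $ i * G p i) \<le> real N * ?J p / \<epsilon> + (\<Sum>i\<in>UNIV. x $ i * G p i)"
    proof -
      have "0 \<le> ?J p"
        unfolding Jbar_def using p \<open>0 \<le> \<nu>\<close>
        by (intro sum_nonneg mult_nonneg_nonneg c assignment_matrix_entry) (auto simp: F0_def M)
      then show ?thesis using \<open>0 < \<epsilon>\<close> by simp
    qed
    also have "\<dots> \<le> real N * ?J ps / \<epsilon> + Y"
      unfolding Y_def split[symmetric] sum_ps
    proof (intro mult_left_mono sum_mono mult_nonneg_nonneg)
      fix q
      have "(\<Sum>M\<in>Ms q. p q M * w q M) \<le> (\<Sum>M\<in>Ms q. p q M * w q (sel q x))"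
        using p by (intro sum_mono mult_left_mono sel_max) (auto simp: F0_def)
      \<comment> \<open>The values of \<open>p q\<close> sum to at most 1, possibly less;
        nonnegativity of the maximal weight covers the missing mass.\<close>
      also have "\<dots> \<le> w q (sel q x)"
        unfolding sum_distrib_right[symmetric]
        using p w_nonneg[OF sel_in] by (intro mult_left_le_one_le sum_nonneg) (auto simp: F0_def)
      finally show "(\<Sum>M\<in>Ms q. p q M * w q M) \<le> w q (sel q x)" .
    qed (use \<open>0 \<le> \<nu>\<close> in auto)
    also have "real N * ?J ps / \<epsilon> \<le> D3 Ms c \<nu> \<theta> N / \<epsilon>"
      unfolding D3_def using \<open>0 < \<epsilon>\<close>
      by (intro divide_right_mono mult_left_mono cSUP_upper ps bdd_above_Jbar M c \<open>0 \<le> \<nu>\<close>) auto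
    finally show ?thesis by simp
  qed
  have "D2 Ms \<nu> \<theta> N m * X \<le> D3 Ms c \<nu> \<theta> N / \<epsilon> + Y - Z"
  \<comment> \<open>Division by \<open>X\<close>, which does not depend on \<open>p\<close>, carries
    the bound over to the supremum \<open>D2\<close>. For \<open>X = 0\<close> the left-hand side
    vanishes, and \<open>main\<close> at \<open>ps\<close> shows that the right-hand side is
    nonnegative.\<close>
  proof (cases "X = 0")
    case True
    then show ?thesis
      using main ps by auto
  next
    case False
    then have X: "0 < X"
      using sum_nonneg[of UNIV "\<lambda>i. x $ i"] x by (auto simp: X_def)
    have "D2 Ms \<nu> \<theta> N m \<le> (D3 Ms c \<nu> \<theta> N / \<epsilon> + Y - Z) / X"
      unfolding D2_def G_def[symmetric] using main X
      by (intro cSUP_least F0_nonempty) (simp add: pos_le_divide_eq)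
    then show ?thesis
      using X by (simp add: pos_le_divide_eq)
  qed
  then show ?thesis
    by (simp add: G_ps[symmetric] right_diff_distrib sum_subtractf Y_def Z_def X_def)
qed

section \<open>Quadratic drift of the queue vector in one cycle\<close>

lemma finite_set_pmf_vec:
  fixes \<mu> :: "('a^'n) pmf"
  assumes "\<And>i. finite (set_pmf (map_pmf (\<lambda>r. r $ i) \<mu>))"
  shows "finite (set_pmf \<mu>)"
proof (rule finite_subset)
  show "finite {v :: 'a^'n. \<forall>i. v $ i \<in> (\<Union>i. set_pmf (map_pmf (\<lambda>r. r $ i) \<mu>))}"
    using assms by (intro finite_vec_in) auto
qed auto

lemma queue_drift:
  fixes Ms :: "'q::finite \<Rightarrow> (real^'s^'i) set" and m x :: "real^'i"
    and sel :: "'q \<Rightarrow> real^'i \<Rightarrow> real^'s^'i"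
  assumes M: "\<And>q M. M \<in> Ms q \<Longrightarrow> assignment_matrix M"
    and c: "\<And>q i s. 0 \<le> c q i s"
    and \<nu>: "0 \<le> \<nu>" "\<nu> \<le> 1" and "0 < N" and "0 < \<epsilon>"
    and m: "\<And>i. 0 < m $ i"
    and \<mu>: "\<And>i. map_pmf (\<lambda>r. r $ i) \<mu> = requirement_pmf (m $ i)"
    and sel: "online_selection Ms c \<epsilon> sel"
    and x: "\<And>i. 0 \<le> x $ i"
  defines "V \<equiv> \<lambda>x. (\<Sum>i\<in>UNIV. (x $ i)\<^sup>2) / 2"
  shows "integrable (measure_pmf (queue_kernel sel N \<nu> \<theta> \<mu> x)) V"
    and "measure_pmf.expectation (queue_kernel sel N \<nu> \<theta> \<mu> x) V
      \<le> V x - D2 Ms \<nu> \<theta> N m * (\<Sum>i\<in>UNIV. x $ i) + (D1 N CARD('s) m + D3 Ms c \<nu> \<theta> N / \<epsilon>)"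
proof -
  let ?Q = "Pi_pmf {..<N} None (\<lambda>_. query_pmf \<nu> \<theta>)"
  let ?P = "pair_pmf ?Q \<mu>"
  let ?L = "real CARD('s)"
  let ?S = "\<lambda>qs i. service sel N x qs i"
  have sel_M: "assignment_matrix (sel q x)" for q
    using sel x M unfolding online_selection_def is_arg_max_linorder by blast
  have set_req: "set_pmf (requirement_pmf r) \<subseteq> {\<lfloor>r\<rfloor>, \<lceil>r\<rceil>}" for r
    by (auto simp: requirement_pmf_def)
  \<comment> \<open>Each marginal of \<open>\<mu>\<close> has at most two values. The joint
    randomness of a cycle thus has finite support, and every real function of it is
    integrable.\<close>
  have "finite (set_pmf \<mu>)"
    by (intro finite_set_pmf_vec) (auto simp: \<mu> intro: finite_subset[OF set_req])
  moreover have "finite (set_pmf ?Q)"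
    by (auto simp: set_Pi_pmf intro: finite_PiE_dflt)
  ultimately have fin: "finite (set_pmf ?P)"
    by simp
  note int = integrable_measure_pmf_finite[OF fin]
  show "integrable (measure_pmf (queue_kernel sel N \<nu> \<theta> \<mu> x)) V"
    unfolding queue_kernel_def using fin by (intro integrable_measure_pmf_finite) auto
  have r_nonneg: "0 \<le> r $ i" if "r \<in> set_pmf \<mu>" for r i
  proof -
    have "r $ i \<in> set_pmf (requirement_pmf (m $ i))"
      using that by (auto simp flip: \<mu>)
    moreover have "0 \<le> \<lfloor>m $ i\<rfloor>" "0 \<le> \<lceil>m $ i\<rceil>"
      using m[of i] by linarith+
    ultimately show ?thesis
      using set_req[of "m $ i"] by auto
  qed
  \<comment> \<open>A pathwise majorant of the new value of \<open>V\<close>. The squared services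
    are already replaced by their deterministic bound, so its mean follows by linearity from the
    means of the services and the first two moments of each requirement.\<close>
  define R where "R z = V x + (\<Sum>i\<in>UNIV. x $ i * (of_int (snd z $ i) - ?S (fst z) i))
    + ((real N * (real N - 1) * ?L\<^sup>2 + real N * ?L) + (\<Sum>i\<in>UNIV. (of_int (snd z $ i))\<^sup>2)) / 2" for z
  have step: "V (queue_update sel N x qs r) \<le> R (qs, r)" if r: "r \<in> set_pmf \<mu>" for qs r
  proof -
    have "((queue_update sel N x qs r) $ i)\<^sup>2
        \<le> (x $ i)\<^sup>2 + 2 * (x $ i * (of_int (r $ i) - ?S qs i)) + (?S qs i)\<^sup>2 + (of_int (r $ i))\<^sup>2" for i
    proof -
      have cross: "0 \<le> of_int (r $ i) * ?S qs i"
        using r_nonneg[OF r] by (intro mult_nonneg_nonneg service_nonneg sel_M) simp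
      \<comment> \<open>Cutting a real number off at 0 does not increase its square.\<close>
      have "((queue_update sel N x qs r) $ i)\<^sup>2 \<le> (x $ i + (of_int (r $ i) - ?S qs i))\<^sup>2"
        by (auto simp: queue_update_def max_def)
      also have "\<dots> = (x $ i)\<^sup>2 + 2 * (x $ i * (of_int (r $ i) - ?S qs i))
          + (?S qs i)\<^sup>2 + (of_int (r $ i))\<^sup>2 - 2 * (of_int (r $ i) * ?S qs i)"
        by (simp add: power2_eq_square algebra_simps)
      finally show ?thesis
        using cross by linarith
    qed
    then have "2 * V (queue_update sel N x qs r) \<le> (\<Sum>i\<in>UNIV. (x $ i)\<^sup>2
        + 2 * (x $ i * (of_int (r $ i) - ?S qs i)) + (?S qs i)\<^sup>2 + (of_int (r $ i))\<^sup>2)"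
      unfolding V_def by (simp add: sum_mono)
    also have "\<dots> = 2 * V x + 2 * (\<Sum>i\<in>UNIV. x $ i * (of_int (r $ i) - ?S qs i))
        + (\<Sum>i\<in>UNIV. (?S qs i)\<^sup>2) + (\<Sum>i\<in>UNIV. (of_int (r $ i))\<^sup>2)"
      unfolding V_def by (simp add: sum.distrib flip: sum_distrib_left)
    also have "\<dots> \<le> 2 * R (qs, r)"
      using sum_service_squared_le[where sel = sel and x = x and qs = qs, OF sel_M \<open>0 < N\<close>]
      unfolding R_def by (simp add: field_simps)
    finally show ?thesis by simp
  qed
  have exp_req: "measure_pmf.expectation ?P (\<lambda>z. g (snd z $ i)) = measure_pmf.expectation (requirement_pmf (m $ i)) g"
    for g :: "int \<Rightarrow> real" and i
    using integral_map_pmf[of "\<lambda>r. r $ i" \<mu> g] integral_map_pmf[of snd ?P "\<lambda>r. g (r $ i)"]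
    by (simp only: map_snd_pair_pmf \<mu>)
  have exp_serv: "measure_pmf.expectation ?P (\<lambda>z. ?S (fst z) i)
      = real N * (\<Sum>q\<in>UNIV. \<nu> * pmf \<theta> q * (\<Sum>s\<in>UNIV. sel q x $ i $ s))" for i
    using integral_map_pmf[of fst ?P "\<lambda>qs. ?S qs i"] expectation_service[OF \<nu>, of N \<theta> sel x i]
    by (simp only: map_fst_pair_pmf)
  have "measure_pmf.expectation (queue_kernel sel N \<nu> \<theta> \<mu> x) V
      = measure_pmf.expectation ?P (\<lambda>z. V (queue_update sel N x (fst z) (snd z)))"
    by (simp add: queue_kernel_def case_prod_beta)
  also have "\<dots> \<le> measure_pmf.expectation ?P R"
    by (intro integral_mono_AE int) (auto simp: AE_measure_pmf_iff intro: step)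
  also have "\<dots> = V x + (\<Sum>i\<in>UNIV. x $ i *
        (m $ i - real N * (\<Sum>q\<in>UNIV. \<nu> * pmf \<theta> q * (\<Sum>s\<in>UNIV. sel q x $ i $ s))))
      + D1 N CARD('s) m"
    unfolding R_def
    by (simp add: int exp_serv exp_req[of of_int] exp_req[of "\<lambda>k. (of_int k)\<^sup>2"]
        expectation_requirement_pmf_id
        expectation_requirement_pmf[where g = "\<lambda>k. (of_int k)\<^sup>2"] D1_def)
  also have "\<dots> \<le> V x - D2 Ms \<nu> \<theta> N m * (\<Sum>i\<in>UNIV. x $ i) + (D1 N CARD('s) m + D3 Ms c \<nu> \<theta> N / \<epsilon>)"
    using selection_drift_le[where Ms = Ms and \<nu> = \<nu> and m = m and N = N and \<theta> = \<theta>,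
        OF _ c \<nu>(1) \<open>0 < \<epsilon>\<close> sel x] M by force
  finally show "measure_pmf.expectation (queue_kernel sel N \<nu> \<theta> \<mu> x) V
      \<le> V x - D2 Ms \<nu> \<theta> N m * (\<Sum>i\<in>UNIV. x $ i) + (D1 N CARD('s) m + D3 Ms c \<nu> \<theta> N / \<epsilon>)" .
qed

section \<open>Stationary bound on the queues\<close>

lemma chain_law_queue_kernel_nonneg:
  assumes "\<And>i. 0 \<le> x0 $ i" and "x \<in> set_pmf (chain_law (queue_kernel sel N \<nu> \<theta> \<mu>) x0 k)"
  shows "0 \<le> x $ i"
  using assms by (cases k) (auto simp: queue_kernel_def queue_update_def)

theorem theorem4:
  fixes Ms :: "'q::finite \<Rightarrow> (real^'s^'i) set"
    and c :: "'q \<Rightarrow> 'i \<Rightarrow> 's \<Rightarrow> real"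
    and \<nu> \<epsilon> :: real
    and \<theta> :: "'q pmf"
    and N :: nat
    and m :: "real^'i"
    and \<mu> :: "(int^'i) pmf"
    and sel :: "'q \<Rightarrow> real^'i \<Rightarrow> real^'s^'i"
    and Q0 :: "real^'i"
    and \<pi> :: "(real^'i) pmf"
  assumes "\<And>q. Ms q \<noteq> {}"
    and "\<And>q M. M \<in> Ms q \<Longrightarrow> assignment_matrix M"
    and "\<And>q i s. 0 \<le> c q i s \<and> c q i s \<le> 1"
    and "0 < \<nu>" and "\<nu> < 1"
    and "0 < N"
    and "\<And>i. 0 < m $ i"
    and "\<And>i. map_pmf (\<lambda>r. r $ i) \<mu> = requirement_pmf (m $ i)"
    and "0 < \<epsilon>"
    and "online_selection Ms c \<epsilon> sel"
    and "\<And>i. 0 \<le> Q0 $ i"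
    and "0 < D2 Ms \<nu> \<theta> N m"
    and "stationary_distribution (queue_kernel sel N \<nu> \<theta> \<mu>) Q0 \<pi>"
  shows "integrable (measure_pmf \<pi>) (\<lambda>x. \<Sum>i\<in>UNIV. x $ i) \<and>
    measure_pmf.expectation \<pi> (\<lambda>x. \<Sum>i\<in>UNIV. x $ i)
      \<le> 1 / D2 Ms \<nu> \<theta> N m * (D1 N CARD('s) m + D3 Ms c \<nu> \<theta> N / \<epsilon>)"
proof -
  let ?K = "queue_kernel sel N \<nu> \<theta> \<mu>" and ?D2 = "D2 Ms \<nu> \<theta> N m"
  let ?X = "\<lambda>x :: real^'i. \<Sum>i\<in>UNIV. x $ i"
  let ?b = "D1 N CARD('s) m + D3 Ms c \<nu> \<theta> N / \<epsilon>"
  have stat: "bind_pmf \<pi> ?K = \<pi>"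
    and reach: "set_pmf \<pi> \<subseteq> (\<Union>k. set_pmf (chain_law ?K Q0 k))"
    using assms(13) by (auto simp: stationary_distribution_def)
  \<comment> \<open>\<open>online_selection\<close> constrains \<open>sel\<close> on nonnegative
    vectors only, so the drift bound is available just there; the support of \<open>\<pi>\<close>
    consists of reachable states, which are nonnegative.\<close>
  have nonneg: "0 \<le> x $ i" if "x \<in> set_pmf \<pi>" for x i
    using that reach chain_law_queue_kernel_nonneg[OF assms(11)] by blast
  \<comment> \<open>The factor \<open>D2\<close> stays inside \<open>f\<close>, matching the drift
    bound; as it is positive, it keeps \<open>f\<close> nonnegative and can be divided out at the
    end.\<close>
  have "integrable (measure_pmf \<pi>) (\<lambda>x. ?D2 * ?X x) \<and>
      measure_pmf.expectation \<pi> (\<lambda>x. ?D2 * ?X x) \<le> ?b"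
  proof (rule stationary_expectation_le[OF stat, where V = "\<lambda>x. (\<Sum>i\<in>UNIV. (x $ i)\<^sup>2) / 2"])
    fix x assume x: "x \<in> set_pmf \<pi>"
    show "0 \<le> ?D2 * ?X x"
      using assms(12) nonneg[OF x] by (intro mult_nonneg_nonneg sum_nonneg) auto
    note drift = queue_drift[where Ms = Ms and c = c and \<epsilon> = \<epsilon> and m = m and \<nu> = \<nu> and \<theta> = \<theta>, OF _ _ _ _
        assms(6,9,7,8,10) nonneg[OF x]]
    show "integrable (measure_pmf (?K x)) (\<lambda>x. (\<Sum>i\<in>UNIV. (x $ i)\<^sup>2) / 2)"
      using assms(2-5) by (intro drift(1)) auto
    show "measure_pmf.expectation (?K x) (\<lambda>x. (\<Sum>i\<in>UNIV. (x $ i)\<^sup>2) / 2)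
        \<le> (\<Sum>i\<in>UNIV. (x $ i)\<^sup>2) / 2 - ?D2 * ?X x + ?b"
      using assms(2-5) by (intro drift(2)) auto
  qed (auto intro: sum_nonneg)
  then show ?thesis
    using assms(12) by (simp add: field_simps)
qed

end
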